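(* Let $f:\mathbb N\to\mathbb C$ be a function, and for real $x\ge 1$ and $t\in\mathbb R$ let $S(x,t)=\sum_{1\le n\le x} f(n)e^{2\pi i nt}$ and $F(t)=\sum_{n=1}^\infty \frac{f(n)e^{2\pi i nt}}{n}$. Assume that for some constants $C>0$ and $0<\alpha<1$, $$|S(x,t)|\le Cx^{\alpha}\quad\text{for all real } x\ge 1 \text{ and all } t\in\mathbb R.$$ Then $$|F(t+h)-F(t)|\le C_1h^{1-\alpha}\quad\text{for all } t\in\mathbb R \text{ and } h>0,\qquad\text{where } C_1=\frac{6\pi C}{\alpha(1-\alpha)}.$$ Moreover, the same bound (with the same constant $C_1$) holds with $F(t)$ replaced by each of the functions $|F(t)|$, $\operatorname{Re}F(t)$, and $\operatorname{Im}F(t)$. In particular, the functions $F(t)$, $|F(t)|$, $\operatorname{Re}F(t)$, and $\operatorname{Im}F(t)$ are Hölder continuous with exponent $1-\alpha$.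
   Context: $\mathbb N=\{1,2,3,\dots\}$. The infinite series defining $F(t)$ is understood as the limit of its partial sums $\sum_{n=1}^N$ as $N\to\infty$; under the hypothesis of the claim this limit exists for every $t\in\mathbb R$. No other assumptions (such as boundedness) are made on $f$. A function $g$ is Hölder continuous with exponent $\eta\in(0,1)$ if there is a constant $K>0$ such that $|g(x)-g(y)|\le K|x-y|^\eta$ for all $x,y$ in its domain (here $\mathbb R$; the functions are $1$-periodic). *)

theory Defs
  imports "HOL-Analysis.Analysis"
begin

text \<open>
  An arithmetic function on the positive integers is represented by a function on
  \<^typ>\<open>nat\<close>; all sums start at 1, so its value at 0 is never used.
\<close>

definition exp_sum :: "(nat \<Rightarrow> complex) \<Rightarrow> real \<Rightarrow> real \<Rightarrow> complex" where
  "exp_sum f x t =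
     (\<Sum>n | 1 \<le> n \<and> real n \<le> x.
        f n * exp (2 * of_real pi * \<i> * of_nat n * of_real t))"

definition exp_series_partial :: "(nat \<Rightarrow> complex) \<Rightarrow> nat \<Rightarrow> real \<Rightarrow> complex" where
  "exp_series_partial f N t =
     (\<Sum>n = 1..N. f n * exp (2 * of_real pi * \<i> * of_nat n * of_real t) / of_nat n)"

text \<open>
  The value is meaningful only where the partial sums converge.
\<close>

definition exp_series :: "(nat \<Rightarrow> complex) \<Rightarrow> real \<Rightarrow> complex" where
  "exp_series f t = lim (\<lambda>N. exp_series_partial f N t)"

text \<open>
  For \<open>x = y\<close> the right-hand side is 0, since \<open>0 powr \<eta> = 0\<close>.
\<close>

definition holder_continuous :: "real \<Rightarrow> (real \<Rightarrow> 'a::real_normed_vector) \<Rightarrow> bool" where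
  "holder_continuous \<eta> g \<longleftrightarrow>
     0 < \<eta> \<and> \<eta> < 1 \<and> (\<exists>K>0. \<forall>x y. norm (g x - g y) \<le> K * \<bar>x - y\<bar> powr \<eta>)"

end

theory Submission
  imports Defs
begin

text \<open>
  Write \<open>S\<^sub>N\<close> and \<open>F\<^sub>N\<close> for the partial sums of the two series. Summation by parts bounds
  the tail of \<open>F\<close> after \<open>N\<close> terms by \<open>C (1 + 1 / (1 - \<alpha>)) N powr (\<alpha> - 1)\<close>, and since
  \<open>F\<^sub>N' = 2 \<pi> \<i> S\<^sub>N\<close>, the mean value inequality bounds the increment of \<open>F\<^sub>N\<close> by
  \<open>2 \<pi> C N powr \<alpha> h\<close>. Taking \<open>N = \<lfloor>1 / h\<rfloor>\<close> balances the two.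
\<close>

text \<open>The steps sum to at most \<open>b n - b (n + k)\<close>. Since \<open>b\<close>
  decreases to 0 it is nonnegative, so \<open>b n\<close> bounds every later increment of
  \<open>G\<close>. This makes \<open>G\<close> Cauchy, and the bound survives in the limit: one
  majorant gives both convergence and the tail estimate.\<close>

lemma telescoping_bound_convergent:
  fixes G :: "nat \<Rightarrow> 'a::banach" and b :: "nat \<Rightarrow> real"
  assumes step: "\<And>n. norm (G (Suc n) - G n) \<le> b n - b (Suc n)"
    and lim: "b \<longlonglongrightarrow> 0"
  obtains L where "G \<longlonglongrightarrow> L" and "\<And>n. norm (L - G n) \<le> b n"
proof -
  have "decseq b"
    by (intro decseq_SucI) (use step norm_ge_zero in \<open>smt (verit)\<close>)
  then have nonneg: "b n \<ge> 0" for n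
    using decseq_ge[OF _ lim] by blast
  have "norm (G (n + k) - G n) \<le> b n - b (n + k)" for n k
  proof (induction k)
    case (Suc k)
    have "norm (G (n + Suc k) - G n) \<le> norm (G (Suc (n + k)) - G (n + k)) + norm (G (n + k) - G n)"
      using norm_triangle_ineq[of "G (Suc (n + k)) - G (n + k)" "G (n + k) - G n"] by simp
    with Suc step[of "n + k"] show ?case by simp
  qed simp
  then have bound: "norm (G (n + k) - G n) \<le> b n" for n k
    using nonneg[of "n + k"] by (smt (verit))
  have "Cauchy G"
  proof (rule CauchyI')
    fix e :: real
    assume "e > 0"
    then have "eventually (\<lambda>n. b n < e) sequentially"
      using order_tendstoD(2)[OF lim] by blast
    then obtain M where M: "\<And>n. n \<ge> M \<Longrightarrow> b n < e"
      by (auto simp: eventually_sequentially)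
    have "norm (G m - G n) < e" if "m \<ge> M" "n > m" for m n
    proof -
      have "norm (G n - G m) \<le> b m"
        using bound[of m "n - m"] that by simp
      then show ?thesis
        using M[OF that(1)] by (simp add: norm_minus_commute)
    qed
    then show "\<exists>M. \<forall>m\<ge>M. \<forall>n>m. dist (G m) (G n) < e"
      unfolding dist_norm by blast
  qed
  then obtain L where L: "G \<longlonglongrightarrow> L"
    using Cauchy_convergent convergent_def by blast
  have "norm (L - G n) \<le> b n" for n
  proof (rule tendsto_upperbound)
    show "((\<lambda>k. norm (G (k + n) - G n)) \<longlongrightarrow> norm (L - G n)) sequentially"
      by (intro tendsto_intros LIMSEQ_ignore_initial_segment L)
    show "\<forall>\<^sub>F k in sequentially. norm (G (k + n) - G n) \<le> b n"
      using bound[of n] by (simp add: add.commute)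
  qed simp
  with L show ?thesis using that by blast
qed

text \<open>By the mean value theorem the difference is \<open>(1 - a) * z powr (a - 2)\<close> for
  some z between x and x + 1, and this power decreases in z. The lemma stands in for the comparison
  of a sum with an integral: it turns terms of order a - 2 into telescoping differences.\<close>

lemma powr_minus_two_le_diff:
  fixes x a :: real
  assumes "x > 0" "a < 1"
  shows "(1 - a) * (x + 1) powr (a - 2) \<le> x powr (a - 1) - (x + 1) powr (a - 1)"
proof -
  have "\<exists>z. z > x \<and> z < x + 1 \<and>
      (x + 1) powr (a - 1) - x powr (a - 1) = (x + 1 - x) * ((a - 1) * z powr (a - 2))"
  proof (rule MVT2)
    fix y assume "x \<le> y" "y \<le> x + 1"
    with assms show "((\<lambda>y. y powr (a - 1)) has_real_derivative (a - 1) * y powr (a - 2)) (at y)"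
      by (auto intro!: derivative_eq_intros)
  qed simp
  then obtain z where z: "x < z" "z < x + 1"
    "(x + 1) powr (a - 1) - x powr (a - 1) = (a - 1) * z powr (a - 2)"
    by auto
  have "(x + 1) powr (a - 2) \<le> z powr (a - 2)"
    using z assms by (intro powr_mono2') auto
  then have "(1 - a) * (x + 1) powr (a - 2) \<le> (1 - a) * z powr (a - 2)"
    using assms by (intro mult_left_mono) auto
  with z(3) show ?thesis by (simp add: algebra_simps)
qed

lemma exp_sum_of_nat:
  "exp_sum f (real N) t = (\<Sum>n = 1..N. f n * exp (2 * of_real pi * \<i> * of_nat n * of_real t))"
  unfolding exp_sum_def by (rule sum.cong) auto

text \<open>The new term is expressed through consecutive exponential sums, as summation by parts
  requires.\<close>

lemma exp_series_partial_Suc: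
  "exp_series_partial f (Suc N) t = exp_series_partial f N t
     + (exp_sum f (real (Suc N)) t - exp_sum f (real N) t) / of_nat (Suc N)"
  unfolding exp_series_partial_def exp_sum_of_nat by simp

text \<open>Differentiation brings down a factor n that cancels the denominator of each term, so
  only the unweighted sum remains.\<close>

lemma exp_series_partial_has_vector_derivative:
  "(exp_series_partial f N has_vector_derivative 2 * of_real pi * \<i> * exp_sum f (real N) t) (at t)"
proof -
  have "((\<lambda>t. exp (2 * of_real pi * \<i> * of_nat n * of_real t)) has_vector_derivative
      2 * of_real pi * \<i> * of_nat n * exp (2 * of_real pi * \<i> * of_nat n * of_real t)) (at t)" for n
    by (rule has_vector_derivative_real_field) (auto intro!: derivative_eq_intros)
  then have "((\<lambda>t. f n / of_nat n * exp (2 * of_real pi * \<i> * of_nat n * of_real t)) has_vector_derivative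
      f n / of_nat n * (2 * of_real pi * \<i> * of_nat n * exp (2 * of_real pi * \<i> * of_nat n * of_real t)))
      (at t)" for n
    by (rule has_vector_derivative_mult_right)
  then have "((\<lambda>t. \<Sum>n = 1..N. f n / of_nat n * exp (2 * of_real pi * \<i> * of_nat n * of_real t))
      has_vector_derivative
      (\<Sum>n = 1..N. f n / of_nat n * (2 * of_real pi * \<i> * of_nat n * exp (2 * of_real pi * \<i> * of_nat n * of_real t))))
      (at t)"
    by (intro has_vector_derivative_sum)
  moreover have "(\<lambda>t. \<Sum>n = 1..N. f n / of_nat n * exp (2 * of_real pi * \<i> * of_nat n * of_real t)) =
      exp_series_partial f N"
    by (rule ext) (simp add: exp_series_partial_def)
  moreover have "(\<Sum>n = 1..N. f n / of_nat n * (2 * of_real pi * \<i> * of_nat n * exp (2 * of_real pi * \<i> * of_nat n * of_real t))) =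
      2 * of_real pi * \<i> * exp_sum f (real N) t"
    unfolding exp_sum_of_nat sum_distrib_left by (rule sum.cong) auto
  ultimately show ?thesis by simp
qed

text \<open>This is the mean value inequality; the bound on the exponential sum is uniform in t
  because it has to hold along the whole segment from t to s.\<close>

lemma exp_series_partial_diff_le:
  assumes "\<And>t. norm (exp_sum f (real N) t) \<le> B"
  shows "norm (exp_series_partial f N s - exp_series_partial f N t) \<le> 2 * pi * B * \<bar>s - t\<bar>"
proof -
  have "norm (exp_series_partial f N s - exp_series_partial f N t) \<le> 2 * pi * B * norm (s - t)"
  proof (rule differentiable_bound[of UNIV])
    fix x :: real
    show "(exp_series_partial f N has_derivative
        (\<lambda>u. u *\<^sub>R (2 * of_real pi * \<i> * exp_sum f (real N) x))) (at x within UNIV)"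
      using exp_series_partial_has_vector_derivative[of f N x]
      by (simp add: has_vector_derivative_def)
    show "onorm (\<lambda>u. u *\<^sub>R (2 * of_real pi * \<i> * exp_sum f (real N) x)) \<le> 2 * pi * B"
      by (intro onorm_le) (auto simp: norm_mult mult.commute[of B] intro!: mult_left_mono assms)
  qed auto
  then show ?thesis by simp
qed

text \<open>Removing the boundary term \<open>E N\<close> of the summation by parts from
  \<open>P N\<close> leaves a sequence with steps of order \<open>C * m powr (a - 2)\<close>. These
  telescope to \<open>C / (1 - a) * N powr (a - 1)\<close>, and the boundary term contributes
  another \<open>C * N powr (a - 1)\<close>.\<close>

lemma exp_series_tail:
  fixes C a t :: real
  assumes a: "0 < a" "a < 1"
    and S: "\<And>N. N \<ge> 1 \<Longrightarrow> norm (exp_sum f (real N) t) \<le> C * real N powr a"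
  shows "(\<lambda>N. exp_series_partial f N t) \<longlonglongrightarrow> exp_series f t"
    and "N \<ge> 1 \<Longrightarrow> norm (exp_series f t - exp_series_partial f N t)
           \<le> C * (1 + 1 / (1 - a)) * real N powr (a - 1)"
proof -
  define E where "E N = exp_sum f (real N) t / of_nat (Suc N)" for N
  define P where "P N = exp_series_partial f N t" for N
  \<comment> \<open>The index is shifted by one because \<open>0 powr (a - 1)\<close> is 0, so the
    unshifted power would not be decreasing from 0 on.\<close>
  define b where "b n = C / (1 - a) * real (Suc n) powr (a - 1)" for n
  have "0 \<le> norm (exp_sum f (real 1) t)" by simp
  also have "\<dots> \<le> C" using S[of 1] by simp
  finally have C: "0 \<le> C" .
  have E_bound: "norm (E N) \<le> C * real N powr (a - 1)" if "N \<ge> 1" for N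
  proof -
    have "norm (E N) = norm (exp_sum f (real N) t) / real (Suc N)"
      unfolding E_def by (simp add: norm_divide del: of_nat_Suc)
    also have "\<dots> \<le> C * real N powr a / real N"
      using S[OF that] C that by (intro frac_le) auto
    also have "\<dots> = C * real N powr (a - 1)"
      using that by (simp add: powr_diff)
    finally show ?thesis .
  qed
  have powr_lim: "(\<lambda>n. real n powr (a - 1)) \<longlonglongrightarrow> 0"
    using a by (intro tendsto_neg_powr filterlim_real_sequentially) auto
  have step: "norm ((P (Suc (Suc n)) - E (Suc (Suc n))) - (P (Suc n) - E (Suc n))) \<le> b n - b (Suc n)" for n
  proof -
    define m where "m = Suc (Suc n)"
    \<comment> \<open>The sum up to m - 1 cancels against \<open>E (m - 1)\<close>, and the sum up
      to m keeps the factor 1/m - 1/(m + 1) = 1/(m (m + 1)).\<close>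
    have "(P (Suc (Suc n)) - E (Suc (Suc n))) - (P (Suc n) - E (Suc n))
        = E m / of_nat m"
    proof -
      have "(p + (x - y) / d - x / (d + 1)) - (p - y / d) = x / (d + 1) / d"
        if "d \<noteq> 0" "d + 1 \<noteq> 0" for p x y d :: complex
      proof -
        have "(p + (x - y) / d - x / (d + 1)) - (p - y / d) = x / d - x / (d + 1)"
          by (simp add: diff_divide_distrib)
        also have "\<dots> = x / (d + 1) / d"
          using that by (simp add: diff_frac_eq algebra_simps)
        finally show ?thesis .
      qed
      from this[of "of_nat m" "P (Suc n)" "exp_sum f (real m) t" "exp_sum f (real (Suc n)) t"]
      show ?thesis
        unfolding P_def E_def m_def exp_series_partial_Suc[of f "Suc n"]
        using of_nat_neq_0[of "Suc (Suc n)", where 'a = complex] of_nat_neq_0[of "Suc n", where 'a = complex]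
        by (simp add: add_ac)
    qed
    then have "norm ((P (Suc (Suc n)) - E (Suc (Suc n))) - (P (Suc n) - E (Suc n))) = norm (E m) / real m"
      by (simp add: norm_divide)
    also have "\<dots> \<le> C * real m powr (a - 1) / real m"
      by (intro divide_right_mono E_bound) (auto simp: m_def)
    also have "\<dots> = C * real m powr (a - 2)"
      using powr_diff[of "real m" "a - 1" 1] by (simp add: m_def)
    \<comment> \<open>The factor 1 - a is inserted to match \<open>powr_minus_two_le_diff\<close> at
      x = m - 1.\<close>
    also have "\<dots> = C / (1 - a) * ((1 - a) * (real (Suc n) + 1) powr (a - 2))"
      using a by (simp add: m_def add_ac)
    also have "\<dots> \<le> C / (1 - a) * (real (Suc n) powr (a - 1) - (real (Suc n) + 1) powr (a - 1))"
      using a C by (intro mult_left_mono powr_minus_two_le_diff) auto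
    also have "\<dots> = b n - b (Suc n)"
      by (simp add: b_def right_diff_distrib add_ac)
    finally show ?thesis .
  qed
  have "b \<longlonglongrightarrow> 0"
    unfolding b_def using tendsto_mult_right_zero[OF LIMSEQ_Suc[OF powr_lim]] by blast
  with step obtain L where L: "(\<lambda>n. P (Suc n) - E (Suc n)) \<longlonglongrightarrow> L"
    and tail: "\<And>n. norm (L - (P (Suc n) - E (Suc n))) \<le> b n"
    using telescoping_bound_convergent[of "\<lambda>n. P (Suc n) - E (Suc n)" b] by blast
  \<comment> \<open>The boundary term vanishes in the limit, so \<open>P\<close> inherits the limit
    of \<open>P - E\<close>.\<close>
  have "E \<longlonglongrightarrow> 0"
  proof (rule Lim_null_comparison)
    show "\<forall>\<^sub>F n in sequentially. norm (E n) \<le> C * real n powr (a - 1)"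
      using E_bound by (auto simp: eventually_sequentially)
    show "(\<lambda>n. C * real n powr (a - 1)) \<longlonglongrightarrow> 0"
      using tendsto_mult_right_zero[OF powr_lim] .
  qed
  with LIMSEQ_imp_Suc[OF L] have P: "P \<longlonglongrightarrow> L"
    using tendsto_add[of "\<lambda>n. P n - E n" L sequentially E 0] by simp
  then have L_eq: "L = exp_series f t"
    unfolding exp_series_def P_def using limI by metis
  from P show "(\<lambda>N. exp_series_partial f N t) \<longlonglongrightarrow> exp_series f t"
    unfolding L_eq P_def .
  assume N: "N \<ge> 1"
  then obtain n where n: "N = Suc n" by (cases N) auto
  have "norm (L - P N) \<le> norm (L - (P N - E N)) + norm (E N)"
    using norm_triangle_ineq4[of "L - (P N - E N)" "E N"] by simp
  also have "\<dots> \<le> C / (1 - a) * real N powr (a - 1) + C * real N powr (a - 1)"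
    using tail[of n] E_bound[OF N] unfolding n b_def by linarith
  also have "\<dots> = C * (1 + 1 / (1 - a)) * real N powr (a - 1)"
    by (simp add: algebra_simps)
  finally show "norm (exp_series f t - exp_series_partial f N t)
      \<le> C * (1 + 1 / (1 - a)) * real N powr (a - 1)"
    unfolding L_eq P_def .
qed

text \<open>The proof gives the constant \<open>C * (2 * pi + 4 * K)\<close>: the first part comes
  from the derivative of the partial sum, the second from two tails, each at most doubled by
  rounding 1/h down to an integer.\<close>

lemma exp_series_increment_bound:
  fixes C a t h :: real
  assumes a: "0 < a" "a < 1" and h: "h > 0"
    and S: "\<And>N t. N \<ge> 1 \<Longrightarrow> norm (exp_sum f (real N) t) \<le> C * real N powr a"
  shows "norm (exp_series f (t + h) - exp_series f t)
           \<le> 6 * pi * C / (a * (1 - a)) * h powr (1 - a)"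
proof -
  define K where "K = 1 + 1 / (1 - a)"
  define F where "F = exp_series f"
  define P where "P = exp_series_partial f"
  have "0 \<le> norm (exp_sum f (real 1) t)" by simp
  also have "\<dots> \<le> C" using S[of 1] by simp
  finally have C: "0 \<le> C" .
  have K: "0 \<le> K" using a by (simp add: K_def)
  have tail: "norm (F s - P N s) \<le> C * K * real N powr (a - 1)" if "N \<ge> 1" for N s
    unfolding F_def P_def K_def using exp_series_tail(2)[OF a S that] by simp
  have split: "norm (F (t + h) - F t) \<le> norm (P N (t + h) - P N t) + 2 * (C * K * real N powr (a - 1))"
    if "N \<ge> 1" for N
  proof -
    have "F (t + h) - F t = (F (t + h) - P N (t + h)) + (P N (t + h) - P N t) - (F t - P N t)"
      by simp
    also have "norm \<dots> \<le> norm (F (t + h) - P N (t + h)) + norm (P N (t + h) - P N t) + norm (F t - P N t)"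
      by (meson norm_triangle_ineq norm_triangle_ineq4 order_trans add_right_mono)
    finally show ?thesis using tail[OF that, of "t + h"] tail[OF that, of t] by linarith
  qed
  \<comment> \<open>Since (1 - a) K = 2 - a, multiplying the left side by a (1 - a) gives at most 2
    \<pi> + 8, which is below 6 \<pi>.\<close>
  have const: "2 * pi + 4 * K \<le> 6 * pi / (a * (1 - a))"
  proof -
    have "a * ((1 - a) * (2 * pi + 4 * K)) = a * (2 * pi * (1 - a) + 4 * (2 - a))"
      using a by (simp add: K_def field_simps)
    also have "\<dots> \<le> 1 * (2 * pi * 1 + 4 * 2)"
      using a by (intro mult_mono add_mono) auto
    also have "\<dots> \<le> 6 * pi" using pi_gt3 by simp
    finally show ?thesis using a by (simp add: pos_le_divide_eq mult_ac)
  qed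
  have "norm (F (t + h) - F t) \<le> C * (2 * pi + 4 * K) * h powr (1 - a)"
  proof (cases "h \<le> 1")
    case True
    \<comment> \<open>As h \<le> 1, this N is at least 1 and lies between 1/(2h) and 1/h. The upper
      bound serves the increment of the partial sum, the lower bound the tails, whose exponent a - 1
      is negative.\<close>
    define N where "N = nat \<lfloor>1 / h\<rfloor>"
    have "1 \<le> 1 / h" using True h by simp
    then have N1: "N \<ge> 1" unfolding N_def by linarith
    have N2: "real N \<le> 1 / h" using h unfolding N_def by simp
    have "1 / h \<le> real N + 1" using h unfolding N_def by linarith
    also have "\<dots> \<le> 2 * real N" using N1 by simp
    finally have N3: "1 / (2 * h) \<le> real N" by simp
    have "norm (P N (t + h) - P N t) \<le> 2 * pi * (C * real N powr a) * h"
      unfolding P_def using exp_series_partial_diff_le[OF S[OF N1], of "t + h" t] h by simp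
    also have "\<dots> \<le> 2 * pi * (C * (1 / h) powr a) * h"
      using a h N2 C by (intro mult_right_mono mult_left_mono powr_mono2) auto
    also have "\<dots> = 2 * pi * C * h powr (1 - a)"
      using h by (simp add: powr_diff powr_divide)
    finally have A: "norm (P N (t + h) - P N t) \<le> 2 * pi * C * h powr (1 - a)" .
    have "real N powr (a - 1) \<le> (1 / (2 * h)) powr (a - 1)"
      using a h N3 by (intro powr_mono2') auto
    also have "\<dots> = (2 * h) powr (1 - a)"
      using h powr_minus_divide[of "2 * h" "a - 1"] by (simp only: powr_divide powr_one_eq_one minus_diff_eq)
    also have "\<dots> = 2 powr (1 - a) * h powr (1 - a)"
      by (rule powr_mult)
    also have "\<dots> \<le> 2 powr 1 * h powr (1 - a)"
      using a by (intro mult_right_mono powr_mono) auto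
    finally have "C * K * real N powr (a - 1) \<le> C * K * (2 * h powr (1 - a))"
      using C K by (intro mult_left_mono) auto
    with split[OF N1] A show ?thesis by (simp add: algebra_simps)
  next
    case False
    \<comment> \<open>For h > 1 no balancing is required: \<open>P 1\<close> is the exponential sum
      with one term, so N = 1 bounds the increment by a constant, and \<open>h powr (1 - a)\<close>
      is at least 1.\<close>
    have "norm (P 1 s) \<le> C" for s
      using S[of 1 s] by (simp add: P_def exp_series_partial_def exp_sum_of_nat[of f 1, simplified])
    then have "norm (P 1 (t + h) - P 1 t) \<le> C + C"
      by (meson norm_triangle_le_diff add_mono)
    with split[of 1] have "norm (F (t + h) - F t) \<le> C * (2 + 2 * K)" by (simp add: algebra_simps)
    also have "\<dots> \<le> C * (2 * pi + 4 * K)"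
      using C K pi_gt3 by (intro mult_left_mono) auto
    also have "\<dots> \<le> C * (2 * pi + 4 * K) * h powr (1 - a)"
      using False a C K ge_one_powr_ge_zero[of h "1 - a"]
      by (simp add: mult_le_cancel_left1 not_less)
    finally show ?thesis .
  qed
  also have "\<dots> \<le> C * (6 * pi / (a * (1 - a))) * h powr (1 - a)"
    using const C by (intro mult_right_mono mult_left_mono) auto
  finally show ?thesis by (simp add: F_def mult_ac)
qed

text \<open>Symmetry of the norm reduces the condition to forward increments; for x = y both sides
  are 0.\<close>

lemma holder_continuousI:
  assumes "0 < \<eta>" "\<eta> < 1" "K > 0"
    and bound: "\<And>t h. h > 0 \<Longrightarrow> norm (g (t + h) - g t) \<le> K * h powr \<eta>"
  shows "holder_continuous \<eta> g"
  unfolding holder_continuous_def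
proof (intro conjI exI[of _ K] allI)
  fix x y :: real
  show "norm (g x - g y) \<le> K * \<bar>x - y\<bar> powr \<eta>"
    using bound[of "x - y" y] bound[of "y - x" x]
    by (cases x y rule: linorder_cases) (auto simp: norm_minus_commute)
qed (use assms in auto)

theorem theorem1p1:
  fixes f :: "nat \<Rightarrow> complex" and C \<alpha> :: real
  assumes "C > 0" and "0 < \<alpha>" and "\<alpha> < 1"
    and "\<And>x t :: real. x \<ge> 1 \<Longrightarrow> norm (exp_sum f x t) \<le> C * x powr \<alpha>"
  shows "let F = exp_series f; C1 = 6 * pi * C / (\<alpha> * (1 - \<alpha>)) in
      (\<forall>t. (\<lambda>N. exp_series_partial f N t) \<longlonglongrightarrow> F t) \<and>
      (\<forall>t h. h > 0 \<longrightarrow> norm (F (t + h) - F t) \<le> C1 * h powr (1 - \<alpha>)) \<and>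
      (\<forall>t h. h > 0 \<longrightarrow> \<bar>norm (F (t + h)) - norm (F t)\<bar> \<le> C1 * h powr (1 - \<alpha>)) \<and>
      (\<forall>t h. h > 0 \<longrightarrow> \<bar>Re (F (t + h)) - Re (F t)\<bar> \<le> C1 * h powr (1 - \<alpha>)) \<and>
      (\<forall>t h. h > 0 \<longrightarrow> \<bar>Im (F (t + h)) - Im (F t)\<bar> \<le> C1 * h powr (1 - \<alpha>)) \<and>
      holder_continuous (1 - \<alpha>) F \<and>
      holder_continuous (1 - \<alpha>) (\<lambda>t. norm (F t)) \<and>
      holder_continuous (1 - \<alpha>) (\<lambda>t. Re (F t)) \<and>
      holder_continuous (1 - \<alpha>) (\<lambda>t. Im (F t))"
proof -
  define F where "F = exp_series f"
  define C1 where "C1 = 6 * pi * C / (\<alpha> * (1 - \<alpha>))"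
  have S: "norm (exp_sum f (real N) t) \<le> C * real N powr \<alpha>" if "N \<ge> 1" for N t
    using assms(4)[of "real N" t] that by simp
  have conv: "(\<lambda>N. exp_series_partial f N t) \<longlonglongrightarrow> F t" for t
    unfolding F_def using exp_series_tail(1)[OF assms(2,3) S] .
  have F: "norm (F (t + h) - F t) \<le> C1 * h powr (1 - \<alpha>)" if "h > 0" for t h
    unfolding F_def C1_def using exp_series_increment_bound[OF assms(2,3) that S] .
  \<comment> \<open>Modulus, real part and imaginary part are 1-Lipschitz, so each inherits the
    bound with the same constant.\<close>
  have norm: "\<bar>norm (F (t + h)) - norm (F t)\<bar> \<le> C1 * h powr (1 - \<alpha>)" if "h > 0" for t h
    using norm_triangle_ineq3 F[OF that] by (rule order_trans)
  have Re: "\<bar>Re (F (t + h)) - Re (F t)\<bar> \<le> C1 * h powr (1 - \<alpha>)" if "h > 0" for t h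
    using abs_Re_le_cmod[of "F (t + h) - F t"] F[OF that, of t] by simp
  have Im: "\<bar>Im (F (t + h)) - Im (F t)\<bar> \<le> C1 * h powr (1 - \<alpha>)" if "h > 0" for t h
    using abs_Im_le_cmod[of "F (t + h) - F t"] F[OF that, of t] by simp
  \<comment> \<open>The definition of \<open>holder_continuous\<close> asks for a strictly positive
    constant.\<close>
  have "C1 > 0" using assms(1-3) by (simp add: C1_def)
  show ?thesis
    unfolding Let_def F_def[symmetric] C1_def[symmetric]
    using conv F norm Re Im \<open>C1 > 0\<close> assms(2,3)
    by (intro conjI allI impI holder_continuousI[of "1 - \<alpha>" C1]) auto
qed

end
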